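(* Let $0\le\lambda<1$, and let $\mathrm{iid}(\pm1/\sqrt n)$ denote the Rademacher prior, under which the coordinates of $x\in\mathbb{R}^n$ are independent and uniform on $\{1/\sqrt n,-1/\sqrt n\}$. Then $\mathrm{GWig}(\lambda,\mathrm{iid}(\pm1/\sqrt n))$ is contiguous to $\mathrm{GWig}(0)$.
   Context: Spiked Gaussian Wigner model: for $\lambda\ge0$ and a family $\mathcal{X}=\{\mathcal{X}_n\}$ of probability distributions on $\mathbb{R}^n$ (spike prior), $\mathrm{GWig}(\lambda,\mathcal{X})$ is the sequence (in $n$) of distributions of $Y=\lambda xx^\top+\frac1{\sqrt n}W$, where $x\sim\mathcal{X}_n$ and, independently, $W$ is an $n\times n$ symmetric matrix with off-diagonal entries $\mathcal{N}(0,1)$, diagonal entries $\mathcal{N}(0,2)$, all entries independent up to symmetry. $\mathrm{GWig}(0)$ is the case $\lambda=0$. A sequence of distributions $Q_n$ is contiguous to $P_n$ (on the same measurable spaces) if for every sequence of events $A_n$, $P_n(A_n)\to0$ implies $Q_n(A_n)\to0$. *)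

theory Defs
  imports "HOL-Probability.Probability"
begin

text \<open>Since the dimension \<open>n\<close> varies, vectors in \<open>R^n\<close> and \<open>n \<times> n\<close> matrices are represented
  by extensional functions on the index sets \<open>{..<n}\<close> and \<open>{..<n} \<times> {..<n}\<close>, with the product
  Borel sigma-algebras.\<close>

abbreviation vec_space :: "nat \<Rightarrow> (nat \<Rightarrow> real) measure" where
  "vec_space n \<equiv> PiM {..<n} (\<lambda>_. borel)"

abbreviation mat_space :: "nat \<Rightarrow> (nat \<times> nat \<Rightarrow> real) measure" where
  "mat_space n \<equiv> PiM ({..<n} \<times> {..<n}) (\<lambda>_. borel)"

text \<open>\<open>N(0, v)\<close>, parametrized by the variance, whereas \<open>normal_density\<close> takes the standard
  deviation.\<close>

definition gaussian :: "real \<Rightarrow> real measure" where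
  "gaussian v = density lborel (normal_density 0 (sqrt v))"

text \<open>The law of \<open>W\<close>: independent Gaussians indexed by the upper triangle (with diagonal),
  reflected to a symmetric matrix.\<close>

definition wigner_noise :: "nat \<Rightarrow> (nat \<times> nat \<Rightarrow> real) measure" where
  "wigner_noise n =
     distr (PiM {(i, j). i \<le> j \<and> j < n} (\<lambda>(i, j). gaussian (if i = j then 2 else 1)))
       (mat_space n)
       (\<lambda>g. \<lambda>(i, j)\<in>{..<n} \<times> {..<n}. g (min i j, max i j))"

definition spike_prior :: "(nat \<Rightarrow> (nat \<Rightarrow> real) measure) \<Rightarrow> bool" where
  "spike_prior X \<longleftrightarrow> (\<forall>n. prob_space (X n) \<and> sets (X n) = sets (vec_space n))"

definition GWig :: "real \<Rightarrow> (nat \<Rightarrow> (nat \<Rightarrow> real) measure) \<Rightarrow> nat \<Rightarrow> (nat \<times> nat \<Rightarrow> real) measure" where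
  "GWig l X n =
     distr (X n \<Otimes>\<^sub>M wigner_noise n) (mat_space n)
       (\<lambda>(x, W). \<lambda>(i, j)\<in>{..<n} \<times> {..<n}. l * (x i * x j) + 1 / sqrt (real n) * W (i, j))"

text \<open>\<open>GWig(0)\<close>, in which the prior is irrelevant; see \<open>GWig_0_eq\<close> below.\<close>

definition GWig_null :: "nat \<Rightarrow> (nat \<times> nat \<Rightarrow> real) measure" where
  "GWig_null n =
     distr (wigner_noise n) (mat_space n)
       (\<lambda>W. \<lambda>(i, j)\<in>{..<n} \<times> {..<n}. 1 / sqrt (real n) * W (i, j))"

text \<open>The identity pushforward only replaces the discrete sigma-algebra by the Borel one.\<close>

definition rademacher_prior :: "nat \<Rightarrow> (nat \<Rightarrow> real) measure" where
  "rademacher_prior n =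
     PiM {..<n} (\<lambda>_. distr (measure_pmf (pmf_of_set {1 / sqrt (real n), - 1 / sqrt (real n)}))
       borel (\<lambda>x. x))"

definition contiguous :: "(nat \<Rightarrow> 'a measure) \<Rightarrow> (nat \<Rightarrow> 'a measure) \<Rightarrow> bool" where
  "contiguous Q P \<longleftrightarrow>
     (\<forall>n. sets (Q n) = sets (P n)) \<and>
     (\<forall>A. (\<forall>n. A n \<in> sets (P n)) \<longrightarrow>
          (\<lambda>n. measure (P n) (A n)) \<longlonglongrightarrow> 0 \<longrightarrow>
          (\<lambda>n. measure (Q n) (A n)) \<longlonglongrightarrow> 0)"

lemma sets_gaussian [measurable_cong]: "sets (gaussian v) = sets borel"
  by (simp add: gaussian_def)

lemma prob_space_gaussian: "v > 0 \<Longrightarrow> prob_space (gaussian v)"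
  unfolding gaussian_def by (rule prob_space_normal_density) simp

lemma wigner_noise_measurable:
  "(\<lambda>g. \<lambda>(i, j)\<in>{..<n} \<times> {..<n}. g (min i j, max i j)) \<in>
     measurable (PiM {(i, j). i \<le> j \<and> j < n} (\<lambda>(i, j). gaussian (if i = j then 2 else 1)))
       (mat_space n)"
proof (rule measurable_restrict, clarsimp)
  fix i j :: nat assume "i < n" "j < n"
  then have m: "(min i j, max i j) \<in> {(i, j). i \<le> j \<and> j < n}" by auto
  show "(\<lambda>g. g (min i j, max i j)) \<in>
     borel_measurable (PiM {(i, j). i \<le> j \<and> j < n} (\<lambda>(i, j). gaussian (if i = j then 2 else 1)))"
    using measurable_component_singleton[OF m,
        of "\<lambda>(i, j). gaussian (if i = j then 2 else 1)"]
    by (simp add: sets_gaussian cong: measurable_cong_sets)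
qed

lemma sets_wigner_noise [measurable_cong]: "sets (wigner_noise n) = sets (mat_space n)"
  by (simp add: wigner_noise_def)

lemma prob_space_wigner_noise: "prob_space (wigner_noise n)"
  unfolding wigner_noise_def
  by (rule prob_space.prob_space_distr[OF prob_space_PiM wigner_noise_measurable])
     (auto intro: prob_space_gaussian)

lemma wigner_noise_component:
  "q \<in> {..<n} \<times> {..<n} \<Longrightarrow> (\<lambda>W. W q) \<in> borel_measurable (wigner_noise n)"
  using measurable_component_singleton[of q "{..<n} \<times> {..<n}" "\<lambda>_. borel"]
  by (simp add: sets_wigner_noise cong: measurable_cong_sets)

lemma GWig_measurable:
  assumes "spike_prior X"
  shows "(\<lambda>(x, W). \<lambda>(i, j)\<in>{..<n} \<times> {..<n}. l * (x i * x j) + 1 / sqrt (real n) * W (i, j))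
     \<in> measurable (X n \<Otimes>\<^sub>M wigner_noise n) (mat_space n)"
proof -
  have sX: "sets (X n) = sets (vec_space n)"
    using assms by (simp add: spike_prior_def)
  have cX: "(\<lambda>x. x i) \<in> borel_measurable (X n)" if "i < n" for i
    using measurable_component_singleton[of i "{..<n}" "\<lambda>_. borel"] that
    by (simp add: sX cong: measurable_cong_sets)
  have "(\<lambda>p. \<lambda>q\<in>{..<n} \<times> {..<n}. l * (fst p (fst q) * fst p (snd q)) + 1 / sqrt (real n) * snd p q)
     \<in> measurable (X n \<Otimes>\<^sub>M wigner_noise n) (mat_space n)"
    by (rule measurable_restrict)
       (auto intro!: borel_measurable_add borel_measurable_times borel_measurable_const
         measurable_compose[OF measurable_fst cX]
         measurable_compose[OF measurable_snd wigner_noise_component])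
  then show ?thesis
    by (simp add: case_prod_beta')
qed

lemma prob_space_GWig: "spike_prior X \<Longrightarrow> prob_space (GWig l X n)"
  unfolding GWig_def
  by (intro prob_space.prob_space_distr GWig_measurable prob_space_pair prob_space_wigner_noise)
     (auto simp: spike_prior_def)

lemma spike_prior_rademacher: "spike_prior rademacher_prior"
  unfolding spike_prior_def rademacher_prior_def
  by (auto intro!: prob_space_PiM prob_space.prob_space_distr prob_space_measure_pmf sets_PiM_cong)

lemma GWig_0_eq:
  assumes "spike_prior X"
  shows "GWig 0 X n = GWig_null n"
proof -
  interpret X: prob_space "X n" using assms by (simp add: spike_prior_def)
  interpret W: prob_space "wigner_noise n" by (rule prob_space_wigner_noise)
  interpret XW: pair_prob_space "X n" "wigner_noise n" ..
  have "wigner_noise n = distr (X n \<Otimes>\<^sub>M wigner_noise n) (wigner_noise n) snd"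
    by (rule measure_eqI) (auto simp: emeasure_distr W.emeasure_pair_measure_Times X.emeasure_space_1
        space_pair_measure sets.sets_into_space vimage_snd Times_Int_Times Int_absorb1)
  have "(\<lambda>W. \<lambda>q\<in>{..<n} \<times> {..<n}. 1 / sqrt (real n) * W q)
     \<in> measurable (wigner_noise n) (mat_space n)"
    by (rule measurable_restrict)
       (auto intro!: borel_measurable_times borel_measurable_const wigner_noise_component)
  then have "distr (distr (X n \<Otimes>\<^sub>M wigner_noise n) (wigner_noise n) snd) (mat_space n)
      (\<lambda>W. \<lambda>(i, j)\<in>{..<n} \<times> {..<n}. 1 / sqrt (real n) * W (i, j)) = GWig 0 X n"
    unfolding GWig_def
    by (subst distr_distr) (auto simp: case_prod_beta' comp_def)
  then show ?thesis
    using \<open>wigner_noise n = _\<close> by (simp add: GWig_null_def)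
qed

end

theory Submission
  imports Defs
begin

text \<open>Second moment method. Conditionally on \<open>x\<close> the spiked matrix is a shift of the null model, whose
  likelihood ratio \<open>L\<^sub>x\<close> is an explicit Gaussian density. By Cauchy--Schwarz the square of
  \<open>Q\<^sub>n(A) = E\<^sub>P[1\<^sub>A E\<^sub>x L\<^sub>x]\<close> is at most \<open>P\<^sub>n(A)\<close> times the second moment
  \<open>E\<^sub>x E\<^sub>x\<^sub>' E\<^sub>P[L\<^sub>x L\<^sub>x\<^sub>'] = E exp(n l^2 \<langle>x, x'\<rangle>^2 / 2)\<close>. Writing the exponential of a square as the moment
  generating function of a standard Gaussian \<open>z\<close>, this is \<open>E\<^sub>z cosh(l z / sqrt n)^n\<close>, and
  \<open>cosh t \<le> exp(t^2 / 2)\<close> bounds it by \<open>E\<^sub>z exp(l^2 z^2 / 2) = 1 / sqrt(1 - l^2)\<close>, uniformly in \<open>n\<close>.\<close>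

section \<open>Shifts of product Gaussian measures\<close>

text \<open>The likelihood ratio of N(c, v) against N(0, v) at \<open>y\<close>, with
  \<open>v\<close> the variance.\<close>

definition gauss_lr :: "real \<Rightarrow> real \<Rightarrow> real \<Rightarrow> real" where
  "gauss_lr v c y = exp (c * y / v - c\<^sup>2 / (2 * v))"

lemma borel_measurable_gauss_lr [measurable (raw)]:
  assumes [measurable]: "f \<in> borel_measurable M" "g \<in> borel_measurable M"
  shows "(\<lambda>x. gauss_lr v (f x) (g x)) \<in> borel_measurable M"
  unfolding gauss_lr_def by measurable

lemma gauss_lr_nonneg [simp]: "0 \<le> gauss_lr v c y"
  by (simp add: gauss_lr_def)

lemma normal_density_shift_eq_gauss_lr:
  assumes "v > 0"
  shows "normal_density 0 (sqrt v) (y - c) = normal_density 0 (sqrt v) y * gauss_lr v c y"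
proof -
  have "- (y - c)\<^sup>2 / (2 * v) = - y\<^sup>2 / (2 * v) + (c * y / v - c\<^sup>2 / (2 * v))"
    using assms by (simp add: field_simps power2_eq_square)
  then show ?thesis
    using assms by (simp add: normal_density_def gauss_lr_def flip: exp_add)
qed

lemma nn_integral_gaussian:
  fixes f :: "real \<Rightarrow> ennreal"
  assumes [measurable]: "f \<in> borel_measurable borel"
  shows "(\<integral>\<^sup>+y. f y \<partial>gaussian v) = (\<integral>\<^sup>+y. ennreal (normal_density 0 (sqrt v) y) * f y \<partial>lborel)"
  unfolding gaussian_def by (subst nn_integral_density) auto

text \<open>Translation invariance of Lebesgue measure moves the shift from the event to the normal
  density, where completing the square splits off \<open>gauss_lr\<close>.\<close>

lemma distr_gaussian_shift:
  assumes "v > 0"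
  shows "distr (gaussian v) borel (\<lambda>y. c + y) = density (gaussian v) (gauss_lr v c)"
proof (rule measure_eqI)
  fix B assume "B \<in> sets (distr (gaussian v) borel (\<lambda>y. c + y))"
  then have [measurable]: "B \<in> sets borel" by simp
  have "emeasure (distr (gaussian v) borel (\<lambda>y. c + y)) B = (\<integral>\<^sup>+y. indicator B (c + y) \<partial>gaussian v)"
    by (simp flip: nn_integral_indicator add: nn_integral_distr sets_gaussian cong: measurable_cong_sets)
  also have "\<dots> = (\<integral>\<^sup>+y. ennreal (normal_density 0 (sqrt v) y) * indicator B (c + y) \<partial>lborel)"
    by (intro nn_integral_gaussian) measurable
  also have "\<dots> = (\<integral>\<^sup>+y. ennreal (normal_density 0 (sqrt v) (y - c)) * indicator B y \<partial>lborel)"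
    by (subst (2) nn_integral_real_affine[where c=1 and t=c]) auto
  also have "\<dots> = (\<integral>\<^sup>+y. ennreal (normal_density 0 (sqrt v) y) * (ennreal (gauss_lr v c y) * indicator B y) \<partial>lborel)"
    using assms by (intro nn_integral_cong)
      (simp add: normal_density_shift_eq_gauss_lr ennreal_mult mult.assoc)
  also have "\<dots> = emeasure (density (gaussian v) (gauss_lr v c)) B"
    by (subst nn_integral_gaussian[symmetric])
       (auto simp: emeasure_density sets_gaussian cong: measurable_cong_sets)
  finally show "emeasure (distr (gaussian v) borel (\<lambda>y. c + y)) B = \<dots>" .
qed (simp add: sets_gaussian)

lemma nn_integral_gauss_lr:
  assumes "v > 0"
  shows "(\<integral>\<^sup>+y. gauss_lr v c y \<partial>gaussian v) = 1"
proof -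
  interpret prob_space "gaussian v" using assms by (rule prob_space_gaussian)
  have "(\<integral>\<^sup>+y. gauss_lr v c y \<partial>gaussian v) = emeasure (density (gaussian v) (gauss_lr v c)) UNIV"
    by (auto simp: emeasure_density sets_gaussian cong: measurable_cong_sets)
  also have "\<dots> = 1"
    using emeasure_space_1
    by (simp add: distr_gaussian_shift[OF assms, symmetric] emeasure_distr sets_gaussian cong: measurable_cong_sets)
  finally show ?thesis .
qed

text \<open>The integrand is a constant times the likelihood ratio for the shift
  \<open>a * v\<close>, which integrates to 1. Read from right to left, this later linearizes a
  square in an exponent.\<close>

lemma nn_integral_gaussian_exp:
  assumes "v > 0"
  shows "(\<integral>\<^sup>+y. exp (a * y) \<partial>gaussian v) = ennreal (exp (a\<^sup>2 * v / 2))"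
proof -
  have "(\<integral>\<^sup>+y. exp (a * y) \<partial>gaussian v)
      = (\<integral>\<^sup>+y. ennreal (exp (a\<^sup>2 * v / 2)) * gauss_lr v (a * v) y \<partial>gaussian v)"
    using assms by (intro nn_integral_cong)
      (simp add: gauss_lr_def power2_eq_square field_simps flip: ennreal_mult exp_add)
  also have "\<dots> = ennreal (exp (a\<^sup>2 * v / 2))"
    using assms by (subst nn_integral_cmult)
      (auto simp: nn_integral_gauss_lr sets_gaussian cong: measurable_cong_sets)
  finally show ?thesis .
qed

text \<open>Two ratios multiply to the ratio for the shift \<open>c + d\<close>, up to the cross
  term \<open>exp (c * d / v)\<close> left over from the squares; only that constant survives
  integration.\<close>

lemma nn_integral_gauss_lr_mult:
  assumes "v > 0"
  shows "(\<integral>\<^sup>+y. ennreal (gauss_lr v c y) * ennreal (gauss_lr v d y) \<partial>gaussian v)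
    = ennreal (exp (c * d / v))"
proof -
  have eq: "gauss_lr v c y * gauss_lr v d y = exp (c * d / v) * gauss_lr v (c + d) y" for y
    using assms unfolding gauss_lr_def
    by (simp add: power2_eq_square field_simps flip: exp_add)
  have "(\<integral>\<^sup>+y. ennreal (gauss_lr v c y) * ennreal (gauss_lr v d y) \<partial>gaussian v)
      = (\<integral>\<^sup>+y. ennreal (exp (c * d / v)) * gauss_lr v (c + d) y \<partial>gaussian v)"
    by (intro nn_integral_cong) (simp add: eq flip: ennreal_mult)
  also have "\<dots> = ennreal (exp (c * d / v))"
    using assms by (subst nn_integral_cmult)
      (auto simp: nn_integral_gauss_lr sets_gaussian cong: measurable_cong_sets)
  finally show ?thesis .
qed

text \<open>Both sides equal the product of the shifted one-dimensional laws, since a product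
  measure is determined by its values on boxes.\<close>

lemma distr_PiM_gaussian_shift:
  fixes v c :: "'i \<Rightarrow> real"
  assumes I: "finite I" and v: "\<And>p. v p > 0"
  defines "G \<equiv> PiM I (\<lambda>p. gaussian (v p))"
  shows "distr G (PiM I (\<lambda>_. borel)) (\<lambda>g. \<lambda>p\<in>I. c p + g p)
    = density G (\<lambda>g. \<Prod>p\<in>I. ennreal (gauss_lr (v p) (c p) (g p)))"
proof -
  interpret G: product_prob_space "\<lambda>p. gaussian (v p)"
    by (intro product_prob_spaceI prob_space_gaussian v)
  have sG[measurable_cong]: "sets G = sets (PiM I (\<lambda>_. borel))"
    unfolding G_def by (intro sets_PiM_cong) (auto simp: sets_gaussian)
  \<comment> \<open>By \<open>distr_gaussian_shift\<close>, \<open>N p\<close> is both a density and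
    the law of a shifted Gaussian. The second reading makes it a probability measure and settles the
    first box computation; the first reading settles the other.\<close>
  define N where "N = (\<lambda>p. density (gaussian (v p)) (gauss_lr (v p) (c p)))"
  have N: "prob_space (N p)" for p
    unfolding N_def distr_gaussian_shift[OF v, symmetric]
    by (intro prob_space.prob_space_distr prob_space_gaussian v)
       (simp add: sets_gaussian cong: measurable_cong_sets)
  interpret N: product_prob_space N by (intro product_prob_spaceI N)
  have sN: "sets (N p) = sets borel" for p by (simp add: N_def sets_gaussian)
  have sPN: "sets (PiM I N) = sets (PiM I (\<lambda>_. borel))"
    by (intro sets_PiM_cong) (auto simp: sN)
  have comp[measurable]: "(\<lambda>g. g p) \<in> borel_measurable G" if "p \<in> I" for p
    using that by (simp add: sG cong: measurable_cong_sets)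
  have shift: "(\<lambda>g. \<lambda>p\<in>I. c p + g p) \<in> measurable G (PiM I (\<lambda>_. borel))"
    by measurable
  have spG: "space G = PiE I (\<lambda>_. UNIV)"
    using sets_eq_imp_space_eq[OF sG] by (simp add: space_PiM)
  have "distr G (PiM I (\<lambda>_. borel)) (\<lambda>g. \<lambda>p\<in>I. c p + g p) = PiM I N"
  proof (rule N.PiM_eqI[OF I])
    fix A assume "\<And>p. p \<in> I \<Longrightarrow> A p \<in> sets (N p)"
    then have A: "A p \<in> sets borel" if "p \<in> I" for p using that by (simp add: sN)
    have pre: "(\<lambda>y. c p + y) -` A p \<in> sets borel" if "p \<in> I" for p
      using measurable_sets[OF _ A[OF that], of "\<lambda>y. c p + y" borel] by simp
    have "emeasure (distr G (PiM I (\<lambda>_. borel)) (\<lambda>g. \<lambda>p\<in>I. c p + g p)) (Pi\<^sub>E I A)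
        = emeasure G (Pi\<^sub>E I (\<lambda>p. (\<lambda>y. c p + y) -` A p))"
      using I A by (subst emeasure_distr[OF shift])
        (auto intro!: sets_PiM_I_finite arg_cong[where f="emeasure G"] simp: spG PiE_iff)
    also have "\<dots> = (\<Prod>p\<in>I. emeasure (gaussian (v p)) ((\<lambda>y. c p + y) -` A p))"
      unfolding G_def using I pre by (intro G.emeasure_PiM) (auto simp: sets_gaussian)
    also have "\<dots> = (\<Prod>p\<in>I. emeasure (N p) (A p))"
      unfolding N_def distr_gaussian_shift[OF v, symmetric] using A
      by (intro prod.cong refl)
         (auto simp: emeasure_distr sets_gaussian gaussian_def cong: measurable_cong_sets)
    finally show "emeasure (distr G (PiM I (\<lambda>_. borel)) (\<lambda>g. \<lambda>p\<in>I. c p + g p)) (Pi\<^sub>E I A) = \<dots>" .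
  qed (simp add: sPN)
  also have "PiM I N = density G (\<lambda>g. \<Prod>p\<in>I. ennreal (gauss_lr (v p) (c p) (g p)))"
  proof (rule N.PiM_eqI[OF I, symmetric])
    fix A assume "\<And>p. p \<in> I \<Longrightarrow> A p \<in> sets (N p)"
    then have A[measurable]: "A p \<in> sets borel" if "p \<in> I" for p using that by (simp add: sN)
    have "emeasure (density G (\<lambda>g. \<Prod>p\<in>I. ennreal (gauss_lr (v p) (c p) (g p)))) (Pi\<^sub>E I A)
        = (\<integral>\<^sup>+g. (\<Prod>p\<in>I. ennreal (gauss_lr (v p) (c p) (g p))) * indicator (Pi\<^sub>E I A) g \<partial>G)"
      using I A by (subst emeasure_density) (auto simp: sG intro!: sets_PiM_I_finite)
    also have "\<dots> = (\<integral>\<^sup>+g. (\<Prod>p\<in>I. ennreal (gauss_lr (v p) (c p) (g p)) * indicator (A p) (g p)) \<partial>G)"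
    proof (intro nn_integral_cong)
      fix g assume "g \<in> space G"
      \<comment> \<open>Membership in \<open>Pi\<^sub>E I A\<close> is a coordinatewise condition
        only for extensional functions, so the indicator factorizes on the space of
        \<open>G\<close>.\<close>
      then have "g \<in> extensional I" by (simp add: spG PiE_iff)
      then have "indicator (Pi\<^sub>E I A) g = (\<Prod>p\<in>I. indicator (A p) (g p) :: ennreal)"
        using I by (auto simp: indicator_def PiE_iff prod_zero_iff)
      then show "(\<Prod>p\<in>I. ennreal (gauss_lr (v p) (c p) (g p))) * indicator (Pi\<^sub>E I A) g
          = (\<Prod>p\<in>I. ennreal (gauss_lr (v p) (c p) (g p)) * indicator (A p) (g p))"
        by (simp add: prod.distrib)
    qed
    also have "\<dots> = (\<Prod>p\<in>I. \<integral>\<^sup>+y. ennreal (gauss_lr (v p) (c p) y) * indicator (A p) y \<partial>gaussian (v p))"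
      unfolding G_def using I A
      by (intro G.product_nn_integral_prod) (auto simp: sets_gaussian cong: measurable_cong_sets)
    also have "\<dots> = (\<Prod>p\<in>I. emeasure (N p) (A p))"
      using A unfolding N_def
      by (intro prod.cong refl)
         (auto simp: emeasure_density sets_gaussian cong: measurable_cong_sets)
    finally show "emeasure (density G (\<lambda>g. \<Prod>p\<in>I. ennreal (gauss_lr (v p) (c p) (g p)))) (Pi\<^sub>E I A) = \<dots>" .
  qed (simp add: sPN sG)
  finally show ?thesis .
qed

lemma nn_integral_PiM_gauss_lr_mult:
  assumes I: "finite I" and v: "\<And>p. v p > 0"
  shows "(\<integral>\<^sup>+g. (\<Prod>p\<in>I. ennreal (gauss_lr (v p) (c p) (g p)))
      * (\<Prod>p\<in>I. ennreal (gauss_lr (v p) (d p) (g p))) \<partial>PiM I (\<lambda>p. gaussian (v p)))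
    = ennreal (exp (\<Sum>p\<in>I. c p * d p / v p))"
proof -
  interpret G: product_prob_space "\<lambda>p. gaussian (v p)"
    by (intro product_prob_spaceI prob_space_gaussian v)
  show ?thesis
    unfolding prod.distrib[symmetric]
    by (subst G.product_nn_integral_prod[OF I,
          of "\<lambda>p y. ennreal (gauss_lr (v p) (c p) y) * ennreal (gauss_lr (v p) (d p) y)"])
       (auto simp: nn_integral_gauss_lr_mult v exp_sum I prod_ennreal sets_gaussian
             cong: measurable_cong_sets)
qed

section \<open>The second moment method\<close>

text \<open>After exchanging integrals, the left side pairs the mixture ratio \<open>h\<close> with
  the indicator of \<open>A\<close>, and Cauchy-Schwarz applies. The square of \<open>h\<close>
  unfolds into two independent copies \<open>x\<close> and \<open>x'\<close> of the spike. All
  integrals are extended nonnegative, so no finiteness has to be checked.\<close>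

lemma mixture_second_moment:
  assumes X: "prob_space X" and G: "prob_space G"
    and L[measurable]: "case_prod L \<in> borel_measurable (X \<Otimes>\<^sub>M G)"
    and A[measurable]: "A \<in> sets G"
  shows "(\<integral>\<^sup>+x. (\<integral>\<^sup>+g. L x g * indicator A g \<partial>G) \<partial>X)\<^sup>2
    \<le> (\<integral>\<^sup>+x. \<integral>\<^sup>+x'. (\<integral>\<^sup>+g. L x g * L x' g \<partial>G) \<partial>X \<partial>X) * emeasure G A"
proof -
  interpret X: prob_space X by fact
  interpret G: prob_space G by fact
  interpret pair_prob_space X G ..
  define h where "h = (\<lambda>g. \<integral>\<^sup>+x. L x g \<partial>X)"
  have h[measurable]: "h \<in> borel_measurable G"
    unfolding h_def by measurable
  have "(\<integral>\<^sup>+x. \<integral>\<^sup>+g. L x g * indicator A g \<partial>G \<partial>X) = (\<integral>\<^sup>+g. \<integral>\<^sup>+x. L x g * indicator A g \<partial>X \<partial>G)"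
    by (rule Fubini'[symmetric]) measurable
  also have "\<dots> = (\<integral>\<^sup>+g. h g * indicator A g \<partial>G)"
    unfolding h_def by (intro nn_integral_cong nn_integral_multc) measurable
  finally have "(\<integral>\<^sup>+x. (\<integral>\<^sup>+g. L x g * indicator A g \<partial>G) \<partial>X)\<^sup>2
      \<le> (\<integral>\<^sup>+g. (h g)\<^sup>2 \<partial>G) * (\<integral>\<^sup>+g. (indicator A g)\<^sup>2 \<partial>G)"
    by (simp add: Cauchy_Schwarz_nn_integral)
  also have "(\<integral>\<^sup>+g. (indicator A g)\<^sup>2 \<partial>G) = emeasure G A"
    by (subst nn_integral_indicator[OF A, symmetric], intro nn_integral_cong)
       (auto simp: indicator_def)
  \<comment> \<open>The two factors \<open>h\<close> are expanded one after the other, so that each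
    exchange is Fubini for the single pair \<open>X\<close>, \<open>G\<close>.\<close>
  also have "(\<integral>\<^sup>+g. (h g)\<^sup>2 \<partial>G) = (\<integral>\<^sup>+g. \<integral>\<^sup>+x. L x g * h g \<partial>X \<partial>G)"
    by (intro nn_integral_cong) (simp add: nn_integral_multc h_def power2_eq_square)
  also have "\<dots> = (\<integral>\<^sup>+x. \<integral>\<^sup>+g. L x g * h g \<partial>G \<partial>X)"
    by (rule Fubini') measurable
  also have "\<dots> = (\<integral>\<^sup>+x. \<integral>\<^sup>+g. \<integral>\<^sup>+x'. L x g * L x' g \<partial>X \<partial>G \<partial>X)"
    by (intro nn_integral_cong) (simp add: nn_integral_cmult h_def)
  also have "\<dots> = (\<integral>\<^sup>+x. \<integral>\<^sup>+x'. \<integral>\<^sup>+g. L x g * L x' g \<partial>G \<partial>X \<partial>X)"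
    by (intro nn_integral_cong Fubini') measurable
  finally show ?thesis .
qed

text \<open>Since \<open>C\<close> does not depend on \<open>n\<close>, the bound squeezes the
  \<open>Q\<close>-probabilities below \<open>sqrt (C * measure (P n) (A n))\<close>, which tends to
  0. Limits ignore \<open>n = 0\<close>, where scaling by \<open>1 / sqrt (real n)\<close>
  degenerates.\<close>

lemma contiguous_if_emeasure_power2_le:
  fixes C :: real
  assumes C: "0 \<le> C" and sets: "\<And>n. sets (Q n) = sets (P n)"
    and Q: "\<And>n. prob_space (Q n)" and P: "\<And>n. prob_space (P n)"
    and le: "\<And>n A. n > 0 \<Longrightarrow> A \<in> sets (P n) \<Longrightarrow>
      (emeasure (Q n) A)\<^sup>2 \<le> ennreal C * emeasure (P n) A"
  shows "contiguous Q P"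
  unfolding contiguous_def
proof (intro conjI allI impI sets)
  fix A assume A: "\<forall>n. A n \<in> sets (P n)" and lim: "(\<lambda>n. measure (P n) (A n)) \<longlonglongrightarrow> 0"
  have "(measure (Q n) (A n))\<^sup>2 \<le> C * measure (P n) (A n)" if "n > 0" for n
  proof -
    interpret Q: prob_space "Q n" by (rule Q)
    interpret P: prob_space "P n" by (rule P)
    have "ennreal ((measure (Q n) (A n))\<^sup>2) \<le> ennreal C * ennreal (measure (P n) (A n))"
      using le[OF that, of "A n"] A
      by (simp add: Q.emeasure_eq_measure P.emeasure_eq_measure ennreal_power)
    then show ?thesis
      using C by (simp flip: ennreal_mult)
  qed
  then have "\<forall>\<^sub>F n in sequentially. measure (Q n) (A n) \<le> sqrt (C * measure (P n) (A n))"
    by (intro eventually_mono[OF eventually_gt_at_top[of 0]] real_le_rsqrt)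
  moreover have "(\<lambda>n. sqrt (C * measure (P n) (A n))) \<longlonglongrightarrow> 0"
    using tendsto_real_sqrt[OF tendsto_mult_right_zero[OF lim, of C]] by simp
  ultimately show "(\<lambda>n. measure (Q n) (A n)) \<longlonglongrightarrow> 0"
    by (intro tendsto_sandwich[of "\<lambda>_. 0" "\<lambda>n. measure (Q n) (A n)" sequentially
          "\<lambda>n. sqrt (C * measure (P n) (A n))" 0])
       (simp_all add: always_eventually)
qed

section \<open>The Gaussian Wigner model\<close>

text \<open>The diagonal variance 2 pays off here: halving the diagonal terms makes the sum over the
  triangle exactly half of the full symmetric double sum.\<close>

lemma sum_upper_triangle:
  fixes a :: "nat \<Rightarrow> real"
  shows "(\<Sum>(i, j)\<in>{(i, j). i \<le> j \<and> j < n}. a i * a j / (if i = j then 2 else 1))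
    = (\<Sum>i<n. a i)\<^sup>2 / 2"
proof -
  \<comment> \<open>Swapping coordinates makes the column \<open>j\<close> the outer index, so that
    induction on \<open>n\<close> adds one column at a time.\<close>
  have I: "{(i, j). i \<le> j \<and> j < n} = prod.swap ` (SIGMA j:{..<n}. {..j})" by force
  have "(\<Sum>(i, j)\<in>{(i, j). i \<le> j \<and> j < n}. a i * a j / (if i = j then 2 else 1))
      = (\<Sum>j<n. \<Sum>i\<le>j. a i * a j / (if i = j then 2 else 1))"
    unfolding I by (subst sum.reindex) (auto simp: sum.Sigma intro!: sum.cong)
  also have "\<dots> = (\<Sum>j<n. (\<Sum>i<j. a i) * a j + (a j)\<^sup>2 / 2)"
    by (intro sum.cong refl)
       (simp add: lessThan_Suc_atMost[symmetric] sum_distrib_right power2_eq_square)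
  also have "\<dots> = (\<Sum>i<n. a i)\<^sup>2 / 2"
    by (induction n) (auto simp: power2_eq_square field_simps)
  finally show ?thesis .
qed

section \<open>Triangular coordinates for the noise and the spike\<close>

abbreviation tri :: "nat \<Rightarrow> (nat \<times> nat) set" where
  "tri n \<equiv> {(i, j). i \<le> j \<and> j < n}"

abbreviation var :: "nat \<times> nat \<Rightarrow> real" where
  "var p \<equiv> if fst p = snd p then 2 else 1"

text \<open>The independent entries before reflection. Likelihood ratios are computed here because
  the reflected matrix repeats coordinates and is in general not a product measure.\<close>

definition tri_noise :: "nat \<Rightarrow> (nat \<times> nat \<Rightarrow> real) measure" where
  "tri_noise n = PiM (tri n) (\<lambda>p. gaussian (var p))"

definition tri_to_mat :: "nat \<Rightarrow> (nat \<times> nat \<Rightarrow> real) \<Rightarrow> nat \<times> nat \<Rightarrow> real" where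
  "tri_to_mat n g = (\<lambda>(i, j)\<in>{..<n} \<times> {..<n}. 1 / sqrt (real n) * g (min i j, max i j))"

text \<open>The factor \<open>sqrt (real n)\<close> anticipates the scaling in
  \<open>tri_to_mat\<close>: the shift acts on the noise before it is divided by
  \<open>sqrt (real n)\<close>.\<close>

definition spike_shift :: "real \<Rightarrow> nat \<Rightarrow> (nat \<Rightarrow> real) \<Rightarrow> nat \<times> nat \<Rightarrow> real" where
  "spike_shift l n x p = l * sqrt (real n) * (x (fst p) * x (snd p))"

definition spike_lr :: "real \<Rightarrow> nat \<Rightarrow> (nat \<Rightarrow> real) \<Rightarrow> (nat \<times> nat \<Rightarrow> real) \<Rightarrow> ennreal" where
  "spike_lr l n x g = (\<Prod>p\<in>tri n. ennreal (gauss_lr (var p) (spike_shift l n x p) (g p)))"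

lemma finite_tri: "finite (tri n)"
  by (rule finite_subset[of _ "{..n} \<times> {..n}"]) auto

lemma sets_tri_noise: "sets (tri_noise n) = sets (PiM (tri n) (\<lambda>_. borel))"
  unfolding tri_noise_def by (intro sets_PiM_cong) (auto simp: sets_gaussian)

lemma tri_noise_component [measurable]: "p \<in> tri n \<Longrightarrow> (\<lambda>g. g p) \<in> borel_measurable (tri_noise n)"
  by (simp add: sets_tri_noise cong: measurable_cong_sets)

lemma prob_space_tri_noise: "prob_space (tri_noise n)"
  unfolding tri_noise_def by (intro prob_space_PiM prob_space_gaussian) auto

lemma measurable_tri_to_mat [measurable]: "tri_to_mat n \<in> measurable (tri_noise n) (mat_space n)"
proof -
  have "(\<lambda>g. g (min i j, max i j)) \<in> borel_measurable (tri_noise n)" if "i < n" "j < n" for i j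
    using that by (intro tri_noise_component) auto
  then show ?thesis
    unfolding tri_to_mat_def
    by (intro measurable_restrict) (auto simp: case_prod_beta')
qed

lemma wigner_noise_eq_distr_tri_noise:
  "wigner_noise n = distr (tri_noise n) (mat_space n)
     (\<lambda>g. \<lambda>(i, j)\<in>{..<n} \<times> {..<n}. g (min i j, max i j))"
  by (simp add: wigner_noise_def tri_noise_def case_prod_beta')

lemma measurable_reflect:
  "(\<lambda>g. \<lambda>(i, j)\<in>{..<n} \<times> {..<n}. g (min i j, max i j)) \<in> measurable (tri_noise n) (mat_space n)"
  using wigner_noise_measurable[of n] by (simp add: tri_noise_def case_prod_beta')

lemma GWig_null_eq_distr_tri_noise:
  "GWig_null n = distr (tri_noise n) (mat_space n) (tri_to_mat n)"
proof -
  have "(\<lambda>W. \<lambda>q\<in>{..<n} \<times> {..<n}. 1 / sqrt (real n) * W q)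
     \<in> measurable (mat_space n) (mat_space n)"
    by (rule measurable_restrict)
       (auto intro!: borel_measurable_times borel_measurable_const measurable_component_singleton)
  then show ?thesis
    unfolding GWig_null_def wigner_noise_eq_distr_tri_noise
    by (subst distr_distr[OF _ measurable_reflect])
       (auto simp: comp_def tri_to_mat_def case_prod_beta' fun_eq_iff restrict_def
         intro!: distr_cong)
qed

lemma measurable_spike_lr:
  assumes "spike_prior X"
  shows "case_prod (spike_lr l n) \<in> borel_measurable (X n \<Otimes>\<^sub>M tri_noise n)"
proof -
  have sX: "sets (X n) = sets (vec_space n)"
    using assms by (simp add: spike_prior_def)
  have [measurable]: "(\<lambda>x. x i) \<in> borel_measurable (X n)" if "i < n" for i
    using measurable_component_singleton[of i "{..<n}" "\<lambda>_. borel"] that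
    by (simp add: sX cong: measurable_cong_sets)
  have "(\<lambda>z. spike_lr l n (fst z) (snd z)) \<in> borel_measurable (X n \<Otimes>\<^sub>M tri_noise n)"
    unfolding spike_lr_def spike_shift_def
  proof (intro borel_measurable_prod_ennreal)
    fix p assume p: "p \<in> tri n"
    then have [measurable]: "(\<lambda>g. g p) \<in> borel_measurable (tri_noise n)"
      and "fst p < n" "snd p < n" by auto
    then show "(\<lambda>z. ennreal (gauss_lr (var p)
        (l * sqrt (real n) * (fst z (fst p) * fst z (snd p))) (snd z p)))
      \<in> borel_measurable (X n \<Otimes>\<^sub>M tri_noise n)"
      by measurable
  qed
  then show ?thesis by (simp add: case_prod_beta')
qed

text \<open>Given \<open>x\<close>, the spiked matrix is the image under \<open>tri_to_mat\<close>
  of shifted triangular noise. Pulling \<open>A\<close> back to the triangle and trading the shift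
  for its density gives the formula.\<close>

lemma emeasure_GWig:
  assumes X: "spike_prior X" and n: "n > 0" and A: "A \<in> sets (mat_space n)"
  shows "emeasure (GWig l X n) A
    = (\<integral>\<^sup>+x. \<integral>\<^sup>+g. spike_lr l n x g * indicator (tri_to_mat n -` A \<inter> space (tri_noise n)) g
        \<partial>tri_noise n \<partial>X n)"
proof -
  interpret W: prob_space "wigner_noise n" by (rule prob_space_wigner_noise)
  let ?f = "\<lambda>(x, W). \<lambda>(i, j)\<in>{..<n} \<times> {..<n}. l * (x i * x j) + 1 / sqrt (real n) * W (i, j)"
  let ?r = "\<lambda>g. \<lambda>(i, j)\<in>{..<n} \<times> {..<n}. g (min i j, max i j)"
  let ?B = "tri_to_mat n -` A \<inter> space (tri_noise n)"
  let ?s = "\<lambda>x g. \<lambda>p\<in>tri n. spike_shift l n x p + g p"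
  have [measurable]: "?B \<in> sets (tri_noise n)" using A by measurable
  have f: "?f \<in> measurable (X n \<Otimes>\<^sub>M wigner_noise n) (mat_space n)"
    by (rule GWig_measurable[OF X])
  \<comment> \<open>The factors \<open>sqrt (real n)\<close> cancel because \<open>n > 0\<close>,
    and the symmetry of \<open>x i * x j\<close> in \<open>i\<close> and \<open>j\<close> makes the
    shift commute with reflection.\<close>
  have eq: "?f (x, ?r g) = tri_to_mat n (?s x g)" for x g
  proof
    fix q show "?f (x, ?r g) q = tri_to_mat n (?s x g) q"
      using n by (cases q; cases "fst q \<le> snd q")
        (auto simp: tri_to_mat_def spike_shift_def field_simps min_def max_def)
  qed
  have sspace: "?s x g \<in> space (tri_noise n)" for x g
    unfolding sets_eq_imp_space_eq[OF sets_tri_noise] by (auto simp: space_PiM)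
  have "emeasure (GWig l X n) A = (\<integral>\<^sup>+z. indicator A (?f z) \<partial>(X n \<Otimes>\<^sub>M wigner_noise n))"
    unfolding GWig_def using A
    by (subst nn_integral_indicator[symmetric], simp,
        subst nn_integral_distr[OF f borel_measurable_indicator]) auto
  also have "\<dots> = (\<integral>\<^sup>+x. \<integral>\<^sup>+W. indicator A (?f (x, W)) \<partial>wigner_noise n \<partial>X n)"
    using measurable_compose[OF f borel_measurable_indicator[OF A]]
    by (intro W.nn_integral_fst[symmetric]) auto
  also have "\<dots> = (\<integral>\<^sup>+x. \<integral>\<^sup>+g. spike_lr l n x g * indicator ?B g \<partial>tri_noise n \<partial>X n)"
  proof (intro nn_integral_cong)
    fix x assume x: "x \<in> space (X n)"
    have "(\<lambda>W. ?f (x, W)) \<in> measurable (wigner_noise n) (mat_space n)"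
      using x by (intro measurable_compose[OF measurable_Pair1' f])
    then have "(\<lambda>W. indicator A (?f (x, W)) :: ennreal) \<in> borel_measurable (mat_space n)"
      using A by (intro measurable_compose[OF _ borel_measurable_indicator])
        (auto cong: measurable_cong_sets simp: sets_wigner_noise)
    then have "(\<integral>\<^sup>+W. indicator A (?f (x, W)) \<partial>wigner_noise n)
        = (\<integral>\<^sup>+g. indicator A (?f (x, ?r g)) \<partial>tri_noise n)"
      unfolding wigner_noise_eq_distr_tri_noise
      by (subst nn_integral_distr[OF measurable_reflect]) auto
    also have "\<dots> = (\<integral>\<^sup>+g. indicator ?B (?s x g) \<partial>tri_noise n)"
      unfolding eq by (intro nn_integral_cong) (use sspace in \<open>auto simp: indicator_def\<close>)
    also have "\<dots> = emeasure (distr (tri_noise n) (PiM (tri n) (\<lambda>_. borel)) (?s x)) ?B"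
    proof -
      have "?s x \<in> measurable (tri_noise n) (PiM (tri n) (\<lambda>_. borel))"
        by (intro measurable_restrict borel_measurable_add borel_measurable_const tri_noise_component)
      moreover have "?B \<in> sets (PiM (tri n) (\<lambda>_. borel))"
        using \<open>?B \<in> sets (tri_noise n)\<close> by (simp only: sets_tri_noise)
      ultimately show ?thesis
        by (subst nn_integral_indicator[symmetric], simp,
            subst nn_integral_distr[OF _ borel_measurable_indicator]) auto
    qed
    also have "distr (tri_noise n) (PiM (tri n) (\<lambda>_. borel)) (?s x)
        = density (tri_noise n) (spike_lr l n x)"
      unfolding tri_noise_def spike_lr_def
      by (rule distr_PiM_gaussian_shift[OF finite_tri]) auto
    also have "emeasure \<dots> ?B = (\<integral>\<^sup>+g. spike_lr l n x g * indicator ?B g \<partial>tri_noise n)"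
      using measurable_Pair2[OF measurable_spike_lr[OF X, of l n] x]
      by (intro emeasure_density) auto
    finally show "(\<integral>\<^sup>+W. indicator A (?f (x, W)) \<partial>wigner_noise n) = \<dots>" .
  qed
  finally show ?thesis .
qed

text \<open>The cross terms of the coordinates add up to \<open>l\<^sup>2 * real n\<close> times the
  triangular sum for a_i = \<open>x i * x' i\<close>, which \<open>sum_upper_triangle\<close> turns
  into half the squared overlap.\<close>

lemma spike_lr_second_moment:
  "(\<integral>\<^sup>+g. spike_lr l n x g * spike_lr l n x' g \<partial>tri_noise n)
    = ennreal (exp (l\<^sup>2 * real n * (\<Sum>i<n. x i * x' i)\<^sup>2 / 2))"
proof -
  have "(\<Sum>p\<in>tri n. spike_shift l n x p * spike_shift l n x' p / var p)
      = (\<Sum>p\<in>tri n. l\<^sup>2 * real n * (case p of (i, j) \<Rightarrow>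
          (x i * x' i) * (x j * x' j) / (if i = j then 2 else 1)))"
    by (intro sum.cong refl) (auto simp: spike_shift_def power2_eq_square)
  also have "\<dots> = l\<^sup>2 * real n * (\<Sum>i<n. x i * x' i)\<^sup>2 / 2"
    by (simp only: sum_distrib_left[symmetric] sum_upper_triangle)
  finally show ?thesis
    unfolding spike_lr_def tri_noise_def
    by (subst nn_integral_PiM_gauss_lr_mult[OF finite_tri]) auto
qed

section \<open>The overlap of two Rademacher spikes\<close>

text \<open>This is Hoeffding's bound for a fair sign: in \<open>Hoeffdings_lemma_aux\<close> take
  success probability 1/2 and argument \<open>2 * t\<close>. That bound is applied for nonnegative
  arguments, and evenness of cosh covers the rest.\<close>

lemma cosh_le_exp_square_half: "cosh t \<le> exp (t\<^sup>2 / 2)" for t :: real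
proof -
  have *: "cosh t \<le> exp (t\<^sup>2 / 2)" if "t \<ge> 0" for t :: real
  proof -
    have "cosh t = exp (- t) * (1 + (exp (2 * t) - 1) / 2)"
      by (simp add: cosh_field_def field_simps flip: exp_add)
    also have "\<dots> = exp (- (2 * t) * (1 / 2) + ln (1 + 1 / 2 * (exp (2 * t) - 1)))"
    proof -
      have "0 < 1 + 1 / 2 * (exp (2 * t) - 1)"
        using exp_gt_zero[of "2 * t"] by argo
      then show ?thesis by (simp only: exp_add exp_ln) simp
    qed
    also have "\<dots> \<le> exp ((2 * t)\<^sup>2 / 8)"
      using Hoeffdings_lemma_aux[of "2 * t" "1 / 2"] that by simp
    finally show ?thesis by (simp add: power_mult_distrib)
  qed
  show ?thesis using *[of "\<bar>t\<bar>"] by (simp add: cosh_real_abs)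
qed

text \<open>Tilting the standard normal density by the exponential yields \<open>s\<close> times a
  centred normal density of variance 1 / (1 - a), so the integral is \<open>s\<close>. The condition
  \<open>a < 1\<close> keeps this variance finite and positive.\<close>

lemma nn_integral_gaussian_exp_square:
  assumes "0 \<le> a" "a < 1"
  shows "(\<integral>\<^sup>+z. exp (a * z\<^sup>2 / 2) \<partial>gaussian 1) = ennreal (1 / sqrt (1 - a))"
proof -
  define s where "s = 1 / sqrt (1 - a)"
  have s: "s > 0" "s\<^sup>2 = 1 / (1 - a)" using assms by (auto simp: s_def power_divide)
  interpret prob_space "density lborel (normal_density 0 s)"
    using s by (intro prob_space_normal_density)
  have "normal_density 0 1 z * exp (a * z\<^sup>2 / 2) = s * normal_density 0 s z" for z
  proof -
    have "- z\<^sup>2 / 2 + a * z\<^sup>2 / 2 = - z\<^sup>2 / (2 * s\<^sup>2)"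
      using assms by (simp add: s field_simps)
    moreover have "s * (1 / sqrt (2 * pi * s\<^sup>2)) = 1 / sqrt (2 * pi)"
      using s(1) by (simp add: real_sqrt_mult)
    ultimately show ?thesis
      by (simp add: normal_density_def field_simps flip: exp_add)
  qed
  then have "(\<integral>\<^sup>+z. exp (a * z\<^sup>2 / 2) \<partial>gaussian 1) = (\<integral>\<^sup>+z. ennreal s * normal_density 0 s z \<partial>lborel)"
    using s(1) by (subst nn_integral_gaussian) (auto simp flip: ennreal_mult)
  also have "\<dots> = ennreal s"
    using emeasure_space_1 by (simp add: nn_integral_cmult emeasure_density)
  finally show ?thesis by (simp add: s_def)
qed

section \<open>Moment generating function of the overlap\<close>

definition scaled_sign :: "nat \<Rightarrow> real measure" where
  "scaled_sign n = distr (measure_pmf (pmf_of_set {1 / sqrt (real n), - 1 / sqrt (real n)})) borel (\<lambda>x. x)"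

lemma sets_scaled_sign [measurable_cong]: "sets (scaled_sign n) = sets borel"
  by (simp add: scaled_sign_def)

lemma prob_space_scaled_sign: "prob_space (scaled_sign n)"
  unfolding scaled_sign_def
  by (intro prob_space.prob_space_distr prob_space_measure_pmf) auto

lemma rademacher_prior_eq_PiM_scaled_sign: "rademacher_prior n = PiM {..<n} (\<lambda>_. scaled_sign n)"
  by (simp add: rademacher_prior_def scaled_sign_def)

lemma nn_integral_scaled_sign:
  assumes "n > 0" and [measurable]: "f \<in> borel_measurable borel" and "\<And>x. 0 \<le> f x"
  shows "(\<integral>\<^sup>+x. ennreal (f x) \<partial>scaled_sign n)
    = ennreal ((f (1 / sqrt (real n)) + f (- 1 / sqrt (real n))) / 2)"
proof -
  \<comment> \<open>The two atoms must differ for each to carry mass 1/2; at \<open>n = 0\<close>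
    both would be 0.\<close>
  have "1 / sqrt (real n) \<noteq> - 1 / sqrt (real n)" using assms(1) by (simp add: field_simps)
  then show ?thesis
    unfolding scaled_sign_def using assms
    by (subst nn_integral_distr)
       (auto simp: nn_integral_pmf_of_set divide_ennreal[symmetric] simp flip: ennreal_plus)
qed

text \<open>Integrating out \<open>t\<close> leaves a cosh in \<open>s\<close>; as cosh is even,
  both values of \<open>s\<close> give the same result.\<close>

lemma nn_integral_scaled_sign_overlap:
  assumes n: "n > 0"
  shows "(\<integral>\<^sup>+s. \<integral>\<^sup>+t. ennreal (exp (b * (s * t))) \<partial>scaled_sign n \<partial>scaled_sign n)
    = ennreal (cosh (b / real n))"
proof -
  have "(\<integral>\<^sup>+s. \<integral>\<^sup>+t. ennreal (exp (b * (s * t))) \<partial>scaled_sign n \<partial>scaled_sign n)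
      = (\<integral>\<^sup>+s. ennreal (cosh (b * s / sqrt (real n))) \<partial>scaled_sign n)"
    using n by (intro nn_integral_cong, subst nn_integral_scaled_sign) (auto simp: cosh_field_def)
  also have "\<dots> = ennreal (cosh (b / real n))"
    using n by (subst nn_integral_scaled_sign)
      (auto intro!: borel_measurable_continuous_onI continuous_intros)
  finally show ?thesis .
qed

text \<open>The exponent is a sum over coordinates, so the integral factorizes first over
  \<open>x'\<close>, then over \<open>x\<close>, into \<open>n\<close> equal one-coordinate
  factors.\<close>

lemma rademacher_overlap_mgf:
  assumes n: "n > 0"
  shows "(\<integral>\<^sup>+x. \<integral>\<^sup>+x'. ennreal (exp (b * (\<Sum>i<n. x i * x' i))) \<partial>rademacher_prior n \<partial>rademacher_prior n)
    = ennreal (cosh (b / real n) ^ n)"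
proof -
  interpret S: product_prob_space "\<lambda>_. scaled_sign n"
    by (intro product_prob_spaceI prob_space_scaled_sign)
  have "(\<integral>\<^sup>+x. \<integral>\<^sup>+x'. ennreal (exp (b * (\<Sum>i<n. x i * x' i))) \<partial>rademacher_prior n \<partial>rademacher_prior n)
      = (\<integral>\<^sup>+x. \<integral>\<^sup>+x'. (\<Prod>i<n. ennreal (exp (b * (x i * x' i)))) \<partial>rademacher_prior n \<partial>rademacher_prior n)"
    by (simp add: sum_distrib_left exp_sum prod_ennreal)
  also have "\<dots> = (\<integral>\<^sup>+x. (\<Prod>i<n. \<integral>\<^sup>+t. ennreal (exp (b * (x i * t))) \<partial>scaled_sign n) \<partial>rademacher_prior n)"
    unfolding rademacher_prior_eq_PiM_scaled_sign
    by (intro nn_integral_cong S.product_nn_integral_prod)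
       (auto simp: sets_scaled_sign cong: measurable_cong_sets)
  also have "\<dots> = (\<Prod>i<n. \<integral>\<^sup>+s. \<integral>\<^sup>+t. ennreal (exp (b * (s * t))) \<partial>scaled_sign n \<partial>scaled_sign n)"
    unfolding rademacher_prior_eq_PiM_scaled_sign
    by (intro S.product_nn_integral_prod) auto
  also have "\<dots> = ennreal (cosh (b / real n) ^ n)"
    by (simp add: nn_integral_scaled_sign_overlap[OF n] ennreal_power)
  finally show ?thesis .
qed

lemma rademacher_overlap_exp_square:
  assumes n: "n > 0" and l: "0 \<le> l" "l < 1"
  shows "(\<integral>\<^sup>+x. \<integral>\<^sup>+x'. ennreal (exp (l\<^sup>2 * real n * (\<Sum>i<n. x i * x' i)\<^sup>2 / 2))
      \<partial>rademacher_prior n \<partial>rademacher_prior n) \<le> ennreal (1 / sqrt (1 - l\<^sup>2))"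
proof -
  let ?X = "rademacher_prior n" and ?Z = "gaussian 1"
  let ?F = "\<lambda>x x' z. ennreal (exp (l * sqrt (real n) * z * (\<Sum>i<n. x i * x' i)))"
  interpret X: prob_space ?X using spike_prior_rademacher by (simp add: spike_prior_def)
  interpret Z: prob_space ?Z by (rule prob_space_gaussian) simp
  interpret XZ: pair_prob_space ?X ?Z ..
  have [measurable]: "(\<lambda>x. x i) \<in> borel_measurable ?X" if "i < n" for i
    using measurable_component_singleton[of i "{..<n}" "\<lambda>_. borel"] that spike_prior_rademacher
    by (simp add: spike_prior_def cong: measurable_cong_sets)
  have [measurable]: "(\<lambda>z. z) \<in> borel_measurable ?Z"
    by (simp add: sets_gaussian cong: measurable_cong_sets)
  \<comment> \<open>The square in the exponent is linearized by an auxiliary standard Gaussian \<open>z\<close>.\<close>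
  have "(\<integral>\<^sup>+x. \<integral>\<^sup>+x'. ennreal (exp (l\<^sup>2 * real n * (\<Sum>i<n. x i * x' i)\<^sup>2 / 2)) \<partial>?X \<partial>?X)
      = (\<integral>\<^sup>+x. \<integral>\<^sup>+x'. \<integral>\<^sup>+z. ?F x x' z \<partial>?Z \<partial>?X \<partial>?X)"
  proof (intro nn_integral_cong)
    fix x x' :: "nat \<Rightarrow> real"
    show "ennreal (exp (l\<^sup>2 * real n * (\<Sum>i<n. x i * x' i)\<^sup>2 / 2)) = (\<integral>\<^sup>+z. ?F x x' z \<partial>?Z)"
      using nn_integral_gaussian_exp[of 1 "l * sqrt (real n) * (\<Sum>i<n. x i * x' i)"]
      by (simp add: power_mult_distrib mult_ac)
  qed
  \<comment> \<open>The variable \<open>z\<close> is moved outwards past \<open>x'\<close>, then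
    past \<open>x\<close>. With \<open>z\<close> fixed, \<open>rademacher_overlap_mgf\<close>
    applies with \<open>b = l * sqrt (real n) * z\<close>.\<close>
  also have "\<dots> = (\<integral>\<^sup>+x. \<integral>\<^sup>+z. \<integral>\<^sup>+x'. ?F x x' z \<partial>?X \<partial>?Z \<partial>?X)"
    by (intro nn_integral_cong XZ.Fubini'[symmetric]) measurable
  also have "\<dots> = (\<integral>\<^sup>+z. \<integral>\<^sup>+x. \<integral>\<^sup>+x'. ?F x x' z \<partial>?X \<partial>?X \<partial>?Z)"
    by (intro XZ.Fubini'[symmetric]) measurable
  also have "\<dots> = (\<integral>\<^sup>+z. ennreal (cosh (l * z / sqrt (real n)) ^ n) \<partial>?Z)"
  proof (intro nn_integral_cong)
    fix z
    have "l * sqrt (real n) * z / real n = l * z / sqrt (real n)"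
      using n by (simp add: field_simps)
    then show "(\<integral>\<^sup>+x. \<integral>\<^sup>+x'. ?F x x' z \<partial>?X \<partial>?X) = ennreal (cosh (l * z / sqrt (real n)) ^ n)"
      by (simp only: rademacher_overlap_mgf[OF n])
  qed
  also have "\<dots> \<le> (\<integral>\<^sup>+z. ennreal (exp (l\<^sup>2 * z\<^sup>2 / 2)) \<partial>?Z)"
  proof (intro nn_integral_mono ennreal_leI)
    fix z
    \<comment> \<open>The \<open>n\<close>-th power cancels the 1/n from the squared scaling, which
      makes the bound independent of \<open>n\<close>.\<close>
    have "cosh (l * z / sqrt (real n)) ^ n \<le> exp ((l * z / sqrt (real n))\<^sup>2 / 2) ^ n"
      by (intro power_mono cosh_le_exp_square_half) auto
    also have "\<dots> = exp (l\<^sup>2 * z\<^sup>2 / 2)"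
      using n by (simp add: power_mult_distrib power_divide flip: exp_of_nat_mult)
    finally show "cosh (l * z / sqrt (real n)) ^ n \<le> \<dots>" .
  qed
  also have "\<dots> = ennreal (1 / sqrt (1 - l\<^sup>2))"
    using l by (intro nn_integral_gaussian_exp_square) (auto simp: power_less_one_iff abs_square_less_1)
  finally show ?thesis .
qed

section \<open>Contiguity from the uniform second moment bound\<close>

theorem corollary3p12:
  fixes l :: real
  assumes "0 \<le> l" and "l < 1"
  shows "contiguous (GWig l rademacher_prior) GWig_null"
proof (rule contiguous_if_emeasure_power2_le[where C = "1 / sqrt (1 - l\<^sup>2)"])
  note X = spike_prior_rademacher
  fix n
  show "0 \<le> 1 / sqrt (1 - l\<^sup>2)"
    using assms by (simp add: power_le_one)
  show "sets (GWig l rademacher_prior n) = sets (GWig_null n)"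
    by (simp add: GWig_def GWig_null_def)
  show "prob_space (GWig l rademacher_prior n)"
    by (rule prob_space_GWig[OF X])
  show "prob_space (GWig_null n)"
    unfolding GWig_null_eq_distr_tri_noise
    by (intro prob_space.prob_space_distr prob_space_tri_noise measurable_tri_to_mat)
  fix A assume n: "n > 0" and "A \<in> sets (GWig_null n)"
  then have A: "A \<in> sets (mat_space n)" by (simp add: GWig_null_def)
  let ?X = "rademacher_prior n" and ?G = "tri_noise n"
  let ?B = "tri_to_mat n -` A \<inter> space ?G"
  have "(emeasure (GWig l rademacher_prior n) A)\<^sup>2
      = (\<integral>\<^sup>+x. \<integral>\<^sup>+g. spike_lr l n x g * indicator ?B g \<partial>?G \<partial>?X)\<^sup>2"
    by (simp only: emeasure_GWig[OF X n A])
  also have "\<dots> \<le> (\<integral>\<^sup>+x. \<integral>\<^sup>+x'. (\<integral>\<^sup>+g. spike_lr l n x g * spike_lr l n x' g \<partial>?G) \<partial>?X \<partial>?X)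
      * emeasure ?G ?B"
    using X A
    by (intro mixture_second_moment prob_space_tri_noise measurable_spike_lr)
       (auto simp: spike_prior_def intro!: measurable_sets[OF measurable_tri_to_mat])
  also have "\<dots> \<le> ennreal (1 / sqrt (1 - l\<^sup>2)) * emeasure ?G ?B"
    unfolding spike_lr_second_moment
    by (intro mult_right_mono rademacher_overlap_exp_square n assms) auto
  \<comment> \<open>\<open>GWig_null n\<close> is the image of the triangular noise under
    \<open>tri_to_mat\<close>, so the pulled-back event has the null probability of
    \<open>A\<close>.\<close>
  also have "emeasure ?G ?B = emeasure (GWig_null n) A"
    unfolding GWig_null_eq_distr_tri_noise using A by (simp add: emeasure_distr)
  finally show "(emeasure (GWig l rademacher_prior n) A)\<^sup>2
      \<le> ennreal (1 / sqrt (1 - l\<^sup>2)) * emeasure (GWig_null n) A" .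
qed

end
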